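(* Let $0<q<1$, $x\in[0,1]$, and let $n\ge 1$ and $k\ge 0$ be integers. Then the $q$-Meyer-König-Zeller basis function $m_{k,n}^q(x)$ is the coefficient of $t^k$ in the expansion, as a power series in $t$, of $$\frac{(1-x)_q^n}{(1-xt)_q^{n+2}}.$$
   Context: For an integer $k\ge 0$ and $0<q<1$, $[k]_q=\frac{1-q^k}{1-q}$, and $[k]_q!=[k]_q[k-1]_q\cdots[1]_q$ for $k\ge 1$, with $[0]_q!=1$. For integers $n\ge k\ge 0$, $\left[{n\atop k}\right]_q=\frac{[n]_q!}{[k]_q!\,[n-k]_q!}$. For $a,b\in\mathbb{R}$ and an integer $m\ge 0$, $(a-b)_q^m=\prod_{s=0}^{m-1}(a-q^s b)$, with the empty product equal to $1$; thus $(1-x)_q^n=\prod_{s=0}^{n-1}(1-q^s x)$ and $(1-xt)_q^{n+2}=\prod_{s=0}^{n+1}(1-q^s x t)$. The $q$-Meyer-König-Zeller ($q$-MKZ) basis function is $m_{k,n}^q(x)=\left[{n+k+1\atop k}\right]_q x^k(1-x)_q^{n}$ for $x\in[0,1]$. *)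

theory Defs
  imports "HOL-Analysis.FPS_Convergence"
begin

definition q_int :: "real \<Rightarrow> nat \<Rightarrow> real" where
  "q_int q k = (1 - q ^ k) / (1 - q)"

definition q_fact :: "real \<Rightarrow> nat \<Rightarrow> real" where
  "q_fact q k = (\<Prod>i=1..k. q_int q i)"

(* Meaningful for k \<le> n only, because n - k is truncated subtraction. *)
definition q_binomial :: "real \<Rightarrow> nat \<Rightarrow> nat \<Rightarrow> real" where
  "q_binomial q n k = q_fact q n / (q_fact q k * q_fact q (n - k))"

(* q_diff_power q a b m is the q-analogue of (a - b) ^ m, written (a - b)_q^m. *)
definition q_diff_power :: "real \<Rightarrow> real \<Rightarrow> real \<Rightarrow> nat \<Rightarrow> real" where
  "q_diff_power q a b m = (\<Prod>s<m. a - q ^ s * b)"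

(* The q-Meyer-Koenig-Zeller basis function m_{k,n}^q(x). *)
definition q_MKZ :: "real \<Rightarrow> nat \<Rightarrow> nat \<Rightarrow> real \<Rightarrow> real" where
  "q_MKZ q k n x = q_binomial q (n + k + 1) k * x ^ k * q_diff_power q 1 x n"

end

theory Submission
  imports Defs
begin

text \<open>The $q$-Pascal rule says that multiplying
  $\sum_k \left[{m+1+k \atop k}\right]_q (xt)^k$ by $1 - q^{m+1} x t$ lowers $m + 1$ to $m$.
  Iterating down to the geometric series gives the $q$-binomial series for $1/(1-xt)_q^{m+1}$.\<close>

lemma q_int_pos:
  assumes "0 < q" "q < 1" "k > 0"
  shows "q_int q k > 0"
  using assms by (simp add: q_int_def power_Suc_less_one power_less_one_iff)

text \<open>This rests on 1 - q^(m+k) = (1 - q^m) + q^m (1 - q^k).\<close>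

lemma q_int_add: "q_int q (m + k) = q_int q m + q ^ m * q_int q k"
  by (simp add: q_int_def power_add right_diff_distrib flip: add_divide_distrib)

lemma q_fact_pos:
  assumes "0 < q" "q < 1"
  shows "q_fact q k > 0"
  unfolding q_fact_def by (intro prod_pos) (auto intro: q_int_pos assms)

lemma q_fact_0: "q_fact q 0 = 1"
  by (simp add: q_fact_def)

lemma q_fact_Suc: "q_fact q (Suc k) = q_int q (Suc k) * q_fact q k"
  by (simp add: q_fact_def mult.commute)

lemma q_binomial_0_right:
  assumes "0 < q" "q < 1"
  shows "q_binomial q n 0 = 1"
  using q_fact_pos[OF assms, of n] by (simp add: q_binomial_def q_fact_0)

lemma q_binomial_self:
  assumes "0 < q" "q < 1"
  shows "q_binomial q n n = 1"
  using q_fact_pos[OF assms, of n] by (simp add: q_binomial_def q_fact_0)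

text \<open>The q-Pascal rule: split the top factor [m+k+2] of the numerator as [m+1] + q^(m+1)
  [k+1]. Each summand then cancels one factor of the denominator [k+1]! [m+1]!.\<close>

lemma q_binomial_Suc_Suc:
  assumes "0 < q" "q < 1"
  shows "q_binomial q (Suc m + Suc k) (Suc k)
       = q_binomial q (m + Suc k) (Suc k) + q ^ Suc m * q_binomial q (Suc m + k) k"
proof -
  have "q_int q (Suc (Suc (k + m))) = q_int q (Suc m) + q ^ Suc m * q_int q (Suc k)"
    using q_int_add[of q "Suc m" "Suc k"] by (simp add: add.commute)
  moreover have "q_int q (Suc m) \<noteq> 0" "q_int q (Suc k) \<noteq> 0" "q_fact q m \<noteq> 0" "q_fact q k \<noteq> 0"
    using q_int_pos[OF assms] q_fact_pos[OF assms] by (simp_all add: less_imp_neq[symmetric])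
  ultimately show ?thesis
    by (simp add: q_binomial_def q_fact_Suc[of q "Suc (k + m)"] q_fact_Suc[of q m]
        q_fact_Suc[of q k] field_simps)
qed

text \<open>The expansion of 1/(1-xt)_q^(m+1) in t, with \<open>x\<close> fixed. The index
  \<open>m\<close> is one less than the number of factors, and the upper entry \<open>m + k\<close>
  keeps the truncated subtraction in \<open>q_binomial\<close> exact.\<close>

definition q_binomial_fps :: "real \<Rightarrow> real \<Rightarrow> nat \<Rightarrow> real fps" where
  "q_binomial_fps q x m = Abs_fps (\<lambda>k. q_binomial q (m + k) k * x ^ k)"

definition q_diff_power_fps :: "real \<Rightarrow> real \<Rightarrow> nat \<Rightarrow> real fps" where
  "q_diff_power_fps q x m = (\<Prod>s<m. 1 - fps_const (q ^ s * x) * fps_X)"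

lemma fps_nth_linear_mult:
  "fps_nth ((1 - fps_const c * fps_X) * F) k
     = fps_nth F k - (if k = 0 then 0 else c * fps_nth F (k - 1))"
  for c :: "'a :: comm_ring_1"
  by (simp add: left_diff_distrib mult.assoc)

lemma linear_mult_q_binomial_fps_0:
  assumes "0 < q" "q < 1"
  shows "(1 - fps_const x * fps_X) * q_binomial_fps q x 0 = 1"
proof (rule fps_ext)
  fix k show "fps_nth ((1 - fps_const x * fps_X) * q_binomial_fps q x 0) k = fps_nth 1 k"
    by (cases k) (simp_all add: fps_nth_linear_mult q_binomial_fps_def q_binomial_self[OF assms])
qed

lemma linear_mult_q_binomial_fps_Suc:
  assumes "0 < q" "q < 1"
  shows "(1 - fps_const (q ^ Suc m * x) * fps_X) * q_binomial_fps q x (Suc m)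
       = q_binomial_fps q x m"
proof (rule fps_ext)
  fix k
  show "fps_nth ((1 - fps_const (q ^ Suc m * x) * fps_X) * q_binomial_fps q x (Suc m)) k
      = fps_nth (q_binomial_fps q x m) k"
  proof (cases k)
    case 0
    then show ?thesis
      by (simp only: fps_nth_linear_mult) (simp add: q_binomial_fps_def q_binomial_0_right[OF assms])
  next
    case (Suc j)
    then show ?thesis
      \<comment> \<open>The q-Pascal summand carrying \<open>q ^ Suc m\<close> is exactly the
        shifted coefficient that the linear factor subtracts.\<close>
      by (simp only: fps_nth_linear_mult q_binomial_fps_def fps_nth_Abs_fps
            q_binomial_Suc_Suc[OF assms]) (simp add: algebra_simps)
  qed
qed

text \<open>The product telescopes: its last factor, the one with s = m + 1, turns the series of
  index m + 1 into that of index m.\<close>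

lemma q_diff_power_fps_mult_q_binomial_fps:
  assumes "0 < q" "q < 1"
  shows "q_diff_power_fps q x (Suc m) * q_binomial_fps q x m = 1"
proof (induction m)
  case 0
  then show ?case
    using linear_mult_q_binomial_fps_0[OF assms] by (simp add: q_diff_power_fps_def)
next
  case (Suc m)
  have "q_diff_power_fps q x (Suc (Suc m))
      = q_diff_power_fps q x (Suc m) * (1 - fps_const (q ^ Suc m * x) * fps_X)"
    unfolding q_diff_power_fps_def by (rule prod.lessThan_Suc)
  then show ?case
    by (simp only: mult.assoc linear_mult_q_binomial_fps_Suc[OF assms] Suc)
qed

lemma fps_nth_q_diff_power_fps_0: "fps_nth (q_diff_power_fps q x m) 0 = 1"
  by (induction m) (simp_all add: q_diff_power_fps_def)

lemma has_fps_expansion_q_diff_power: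
  "(\<lambda>t. q_diff_power q 1 (x * t) m) has_fps_expansion q_diff_power_fps q x m"
proof -
  \<comment> \<open>Regrouping as \<open>(q ^ s * x) * t\<close> makes each factor linear in t with
    a constant coefficient, so the product expands factor by factor.\<close>
  have "(\<lambda>t. \<Prod>s<m. 1 - (q ^ s * x) * t) has_fps_expansion q_diff_power_fps q x m"
    unfolding q_diff_power_fps_def by (intro fps_expansion_intros)
  then show ?thesis
    by (simp add: q_diff_power_def mult.assoc)
qed

text \<open>Passage from formal series to functions near t = 0: the constant coefficient 1 permits
  inversion, and uniqueness of the formal inverse identifies the result.\<close>

lemma has_fps_expansion_inverse_q_diff_power:
  assumes "0 < q" "q < 1"
  shows "(\<lambda>t. inverse (q_diff_power q 1 (x * t) (Suc m))) has_fps_expansion q_binomial_fps q x m"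
proof -
  have "inverse (q_diff_power_fps q x (Suc m)) = q_binomial_fps q x m"
    by (rule fps_inverse_unique) (rule q_diff_power_fps_mult_q_binomial_fps[OF assms])
  moreover have "(\<lambda>t. inverse (q_diff_power q 1 (x * t) (Suc m)))
      has_fps_expansion inverse (q_diff_power_fps q x (Suc m))"
    by (intro has_fps_expansion_inverse has_fps_expansion_q_diff_power)
       (simp add: fps_nth_q_diff_power_fps_0)
  ultimately show ?thesis by simp
qed

theorem theorem2:
  fixes q x :: real and n k :: nat
  assumes "0 < q" and "q < 1"
    and "x \<in> {0..1}"
    and "n \<ge> 1"
  shows "\<exists>F. (\<lambda>t::real. q_diff_power q 1 x n / q_diff_power q 1 (x * t) (n + 2)) has_fps_expansion F
           \<and> fps_nth F k = q_MKZ q k n x"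
proof (intro exI conjI)
  let ?c = "q_diff_power q 1 x n"
  \<comment> \<open>The n + 2 factors of the denominator call for index \<open>Suc n\<close>, which
    yields the upper entry n + k + 1 of \<open>q_MKZ\<close>; the numerator does not depend on
    t.\<close>
  let ?F = "fps_const ?c * q_binomial_fps q x (Suc n)"
  have "(\<lambda>t. ?c * inverse (q_diff_power q 1 (x * t) (Suc (Suc n)))) has_fps_expansion ?F"
    by (intro has_fps_expansion_cmult_left has_fps_expansion_inverse_q_diff_power assms)
  then show "(\<lambda>t. ?c / q_diff_power q 1 (x * t) (n + 2)) has_fps_expansion ?F"
    by (simp add: divide_inverse)
  show "fps_nth ?F k = q_MKZ q k n x"
    by (simp add: q_binomial_fps_def q_MKZ_def)
qed

end
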